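(* Define $c_0,\ldots,c_n\in\mathbb{Q}[G_{r,n}]$ by the expansion in powers of $x$ $$\sum_{\pi\in G_{r,n}}\binom{\frac{x-1}{r}+n-\mathrm{des}(\pi)}{n}\pi=\sum_{i=0}^n c_ix^i.$$ Then $c_0,\ldots,c_n$ are orthogonal idempotents ($c_i^2=c_i$ for all $i$, and $c_ic_j=0$ for $i\ne j$) which span the colored Eulerian descent algebra. When $r=1$ they reduce to the Eulerian idempotents: $c_i=e_i$ for $1\le i\le n$.
   Context: Let $r,n\ge 1$. Write $i_c$ for a letter $i$ with color $c\in\{0,1,\ldots,r-1\}$, and order colored letters by color first and then by value: $i_c<j_d$ iff $c<d$, or $c=d$ and $i<j$. The group $G_{r,n}$ of $r$-colored permutations is the group of all bijections $\pi$ of $\{i_c:1\le i\le n,\ 0\le c\le r-1\}$ such that $\pi(i_0)=k_l$ implies $\pi(i_a)=k_{l+a}$ for all $a$ (colors modulo $r$), under composition. Such $\pi$ is identified with the word $\pi(1)\cdots\pi(n)$ where $\pi(i):=\pi(i_0)$; if $\tau(i)=j_k$ and $\sigma(j)=l_p$ then $(\sigma\tau)(i)=l_{k+p}$, color taken mod $r$. The descent number $\mathrm{des}(\pi)$ is the number of $i\in\{1,\ldots,n\}$ with $\pi(i)>\pi(i+1)$, where $\pi(n+1):=0_1$ (so $n$ is a descent iff the color of $\pi(n)$ is nonzero). The colored Eulerian descent algebra is the linear span in $\mathbb{Q}[G_{r,n}]$ of the elements $C_i=\sum_{\mathrm{des}(\pi)=i}\pi$, $0\le i\le n$. For $r=1$,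 $G_{1,n}$ is identified with the symmetric group $\mathfrak{S}_n$, and the Eulerian idempotents $e_1,\ldots,e_n\in\mathbb{Q}[\mathfrak{S}_n]$ are defined by $\sum_{\pi\in\mathfrak{S}_n}\binom{x+n-1-\mathrm{des}(\pi)}{n}\pi=\sum_{i=1}^n e_ix^i$, with $\mathrm{des}(\pi)=|\{i\in\{1,\ldots,n-1\}:\pi(i)>\pi(i+1)\}|$. Here $\binom{z}{n}=z(z-1)\cdots(z-n+1)/n!$. *)

theory Defs
  imports "HOL-Algebra.Sym_Groups" "HOL-Computational_Algebra.Polynomial"
    "HOL-Library.Function_Algebras"
begin

section \<open>Rational group algebras of finite groups\<close>

text \<open>Elements of the group algebra of a finite group \<open>G\<close> are functions \<open>'g \<Rightarrow> rat\<close> vanishing outside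
  \<open>carrier G\<close>. Addition and zero are pointwise; the pointwise \<open>*\<close> on functions is \<^emph>\<open>not\<close> the
  product of the algebra, which is \<open>galg_mult G\<close>.\<close>

definition qscale :: "rat \<Rightarrow> ('g \<Rightarrow> rat) \<Rightarrow> 'g \<Rightarrow> rat" where
  "qscale q a = (\<lambda>g. q * a g)"

interpretation galg: vector_space "qscale :: rat \<Rightarrow> ('g \<Rightarrow> rat) \<Rightarrow> 'g \<Rightarrow> rat"
  by unfold_locales (auto simp: qscale_def fun_eq_iff algebra_simps)

definition galg_basis :: "'g \<Rightarrow> 'g \<Rightarrow> rat" where
  "galg_basis g = (\<lambda>h. if h = g then 1 else 0)"

definition galg_mult :: "('g, 'm) monoid_scheme \<Rightarrow> ('g \<Rightarrow> rat) \<Rightarrow> ('g \<Rightarrow> rat) \<Rightarrow> 'g \<Rightarrow> rat" where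
  "galg_mult G a b =
     (\<Sum>g\<in>carrier G. \<Sum>h\<in>carrier G. qscale (a g * b h) (galg_basis (g \<otimes>\<^bsub>G\<^esub> h)))"

text \<open>Linear extension of a map of groups to the group algebras.\<close>

definition galg_map :: "('g, 'm) monoid_scheme \<Rightarrow> ('g \<Rightarrow> 'h) \<Rightarrow> ('g \<Rightarrow> rat) \<Rightarrow> 'h \<Rightarrow> rat" where
  "galg_map G f a = (\<Sum>g\<in>carrier G. qscale (a g) (galg_basis (f g)))"

section \<open>Colored permutations\<close>

text \<open>The letter \<open>i\<close> with color \<open>c\<close> is the pair \<open>(i, c)\<close>.\<close>

type_synonym letter = "nat \<times> nat"

definition letters :: "nat \<Rightarrow> nat \<Rightarrow> letter set" where
  "letters r n = {1..n} \<times> {0..<r}"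

definition letter_less :: "letter \<Rightarrow> letter \<Rightarrow> bool" where
  "letter_less x y \<longleftrightarrow> snd x < snd y \<or> snd x = snd y \<and> fst x < fst y"

text \<open>Bijections of the letters are represented by functions on all pairs that fix every
  pair outside the set of letters, as in \<open>sym_group\<close>.\<close>

definition colored_perms :: "nat \<Rightarrow> nat \<Rightarrow> (letter \<Rightarrow> letter) set" where
  "colored_perms r n = {\<pi>. \<pi> permutes letters r n \<and>
     (\<forall>i\<in>{1..n}. \<forall>k l. \<pi> (i, 0) = (k, l) \<longrightarrow> (\<forall>a<r. \<pi> (i, a) = (k, (l + a) mod r)))}"

definition colored_perm_group :: "nat \<Rightarrow> nat \<Rightarrow> (letter \<Rightarrow> letter) monoid" where
  "colored_perm_group r n = \<lparr>carrier = colored_perms r n, mult = (\<circ>), one = id\<rparr>"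

text \<open>The word of a colored permutation, extended by \<open>0\<close> with color \<open>1\<close> at position \<open>n + 1\<close>.
  For \<open>r = 1\<close> this last symbol still has color \<open>1\<close>, so it exceeds every letter and \<open>n\<close> is
  never a descent.\<close>

definition word :: "nat \<Rightarrow> (letter \<Rightarrow> letter) \<Rightarrow> nat \<Rightarrow> letter" where
  "word n \<pi> i = (if i = n + 1 then (0, 1) else \<pi> (i, 0))"

definition cdes :: "nat \<Rightarrow> (letter \<Rightarrow> letter) \<Rightarrow> nat" where
  "cdes n \<pi> = card {i \<in> {1..n}. letter_less (word n \<pi> (i + 1)) (word n \<pi> i)}"

definition colored_eulerian_sum :: "nat \<Rightarrow> nat \<Rightarrow> nat \<Rightarrow> (letter \<Rightarrow> letter) \<Rightarrow> rat" where
  "colored_eulerian_sum r n i = (\<Sum>\<pi> | \<pi> \<in> colored_perms r n \<and> cdes n \<pi> = i. galg_basis \<pi>)"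

definition colored_eulerian_descent_algebra :: "nat \<Rightarrow> nat \<Rightarrow> ((letter \<Rightarrow> letter) \<Rightarrow> rat) set" where
  "colored_eulerian_descent_algebra r n = galg.span (colored_eulerian_sum r n ` {0..n})"

text \<open>The binomial coefficient of a polynomial; \<open>gchoose\<close> is only available over fields.\<close>

definition poly_choose :: "rat poly \<Rightarrow> nat \<Rightarrow> rat poly" where
  "poly_choose p n = smult (1 / fact n) (\<Prod>i = 0..<n. p - of_nat i)"

text \<open>The coefficient of \<open>\<pi>\<close> in the generating function, as a polynomial in \<open>x = [:0, 1:]\<close>.
  The expansion in powers of \<open>x\<close> is \<open>colored_eulerian_idem_expansion\<close> below.\<close>

definition colored_eulerian_poly :: "nat \<Rightarrow> nat \<Rightarrow> (letter \<Rightarrow> letter) \<Rightarrow> rat poly" where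
  "colored_eulerian_poly r n \<pi> =
     poly_choose (smult (1 / of_nat r) ([:0, 1:] - 1) + of_nat n - of_nat (cdes n \<pi>)) n"

definition colored_eulerian_idem :: "nat \<Rightarrow> nat \<Rightarrow> nat \<Rightarrow> (letter \<Rightarrow> letter) \<Rightarrow> rat" where
  "colored_eulerian_idem r n i =
     (\<Sum>\<pi>\<in>colored_perms r n. qscale (coeff (colored_eulerian_poly r n \<pi>) i) (galg_basis \<pi>))"

section \<open>The symmetric group\<close>

definition des :: "nat \<Rightarrow> (nat \<Rightarrow> nat) \<Rightarrow> nat" where
  "des n \<sigma> = card {i \<in> {1..n - 1}. \<sigma> i > \<sigma> (i + 1)}"

definition eulerian_poly :: "nat \<Rightarrow> (nat \<Rightarrow> nat) \<Rightarrow> rat poly" where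
  "eulerian_poly n \<sigma> = poly_choose ([:0, 1:] + of_nat n - 1 - of_nat (des n \<sigma>)) n"

definition eulerian_idem :: "nat \<Rightarrow> nat \<Rightarrow> (nat \<Rightarrow> nat) \<Rightarrow> rat" where
  "eulerian_idem n i =
     (\<Sum>\<sigma>\<in>carrier (sym_group n). qscale (coeff (eulerian_poly n \<sigma>) i) (galg_basis \<sigma>))"

text \<open>Identification of the colored permutations for \<open>r = 1\<close> with the symmetric group.\<close>

definition forget_colors :: "(letter \<Rightarrow> letter) \<Rightarrow> nat \<Rightarrow> nat" where
  "forget_colors \<pi> = (\<lambda>i. fst (\<pi> (i, 0)))"

section \<open>Consistency of the definitions\<close>

lemma poly_poly_choose: "poly (poly_choose p n) x = poly p x gchoose n"
  by (simp add: poly_choose_def gbinomial_prod_rev poly_prod)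

lemma degree_poly_choose_le:
  assumes "degree p \<le> 1"
  shows "degree (poly_choose p n) \<le> n"
proof -
  have "degree (\<Prod>i = 0..<n. p - of_nat i) \<le> (\<Sum>i = 0..<n. degree (p - of_nat i))"
    using degree_prod_sum_le[of "{0..<n}" "\<lambda>i. p - of_nat i"] by (simp add: comp_def)
  also have "\<dots> \<le> (\<Sum>i = 0..<n. 1)"
    using assms by (intro sum_mono degree_diff_le) auto
  finally show ?thesis by (simp add: poly_choose_def)
qed

lemma poly_expand_le: "degree p \<le> n \<Longrightarrow> poly p x = (\<Sum>i = 0..n. coeff p i * x ^ i)"
  for x :: rat
  by (simp add: poly_altdef coeff_eq_0 atMost_atLeast0)
    (rule sum.mono_neutral_left, auto simp: coeff_eq_0)

lemma sum_fun_apply: "(\<Sum>i\<in>A. f i) x = (\<Sum>i\<in>A. f i x)"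
  by (induction A rule: infinite_finite_induct) auto

lemma colored_eulerian_idem_expansion:
  "(\<Sum>\<pi>\<in>colored_perms r n.
      qscale (((x - 1) / of_nat r + of_nat n - of_nat (cdes n \<pi>)) gchoose n) (galg_basis \<pi>)) =
   (\<Sum>i = 0..n. qscale (x ^ i) (colored_eulerian_idem r n i))"
proof -
  have "degree (colored_eulerian_poly r n \<pi>) \<le> n" for \<pi>
    unfolding colored_eulerian_poly_def
    by (intro degree_poly_choose_le degree_diff_le degree_add_le) (auto intro: degree_diff_le)
  then have "poly (colored_eulerian_poly r n \<pi>) x =
      (\<Sum>i = 0..n. coeff (colored_eulerian_poly r n \<pi>) i * x ^ i)" for \<pi>
    by (rule poly_expand_le)
  moreover have "poly (colored_eulerian_poly r n \<pi>) x =
      ((x - 1) / of_nat r + of_nat n - of_nat (cdes n \<pi>)) gchoose n" for \<pi>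
    by (simp add: colored_eulerian_poly_def poly_poly_choose)
  ultimately show ?thesis
    unfolding colored_eulerian_idem_def
    by (simp add: fun_eq_iff sum_fun_apply qscale_def sum_distrib_left sum_distrib_right
        sum.swap[of _ "{0..n}"] mult_ac)
qed

lemma eulerian_idem_expansion:
  assumes "n \<ge> 1"
  shows "(\<Sum>\<sigma>\<in>carrier (sym_group n).
      qscale ((x + of_nat n - 1 - of_nat (des n \<sigma>)) gchoose n) (galg_basis \<sigma>)) =
   (\<Sum>i = 1..n. qscale (x ^ i) (eulerian_idem n i))"
proof -
  have deg: "degree (eulerian_poly n \<sigma>) \<le> n" for \<sigma>
    unfolding eulerian_poly_def
    by (intro degree_poly_choose_le degree_diff_le degree_add_le) auto
  have p: "poly (eulerian_poly n \<sigma>) y = (y + of_nat n - 1 - of_nat (des n \<sigma>)) gchoose n" for \<sigma> y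
    by (simp add: eulerian_poly_def poly_poly_choose)
  have "coeff (eulerian_poly n \<sigma>) 0 = 0" for \<sigma>
  proof -
    have "des n \<sigma> \<le> card {1..n - 1}"
      unfolding des_def by (rule card_mono) auto
    then have le: "des n \<sigma> \<le> n - 1" by simp
    then have "(0 + of_nat n - 1 - of_nat (des n \<sigma>) :: rat) = of_nat (n - 1 - des n \<sigma>)"
      using assms by (simp add: of_nat_diff)
    moreover have "(n - 1 - des n \<sigma>) choose n = 0"
      using assms by (intro binomial_eq_0) auto
    ultimately have "poly (eulerian_poly n \<sigma>) 0 = 0"
      unfolding p by (metis binomial_gbinomial of_nat_0)
    then show ?thesis by (simp add: poly_0_coeff_0)
  qed
  then have "poly (eulerian_poly n \<sigma>) x = (\<Sum>i = 1..n. coeff (eulerian_poly n \<sigma>) i * x ^ i)" for \<sigma>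
    unfolding poly_expand_le[OF deg]
    by (simp add: sum.atLeast_Suc_atMost)
  then show ?thesis
    unfolding eulerian_idem_def p
    by (simp add: fun_eq_iff sum_fun_apply qscale_def sum_distrib_left sum_distrib_right
        sum.swap[of _ "{Suc 0..n}"] mult_ac)
qed

lemma colored_perms_comp:
  assumes "\<pi> \<in> colored_perms r n" "\<rho> \<in> colored_perms r n"
  shows "\<pi> \<circ> \<rho> \<in> colored_perms r n"
proof -
  have "(\<pi> \<circ> \<rho>) (i, a) = (k, (l + a) mod r)"
    if i: "i \<in> {1..n}" and kl: "(\<pi> \<circ> \<rho>) (i, 0) = (k, l)" and a: "a < r" for i k l a
  proof -
    obtain j c where jc: "\<rho> (i, 0) = (j, c)" by fastforce
    obtain m d where md: "\<pi> (j, 0) = (m, d)" by fastforce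
    have "(i, 0) \<in> letters r n" using i a by (auto simp: letters_def)
    then have "(j, c) \<in> letters r n"
      using permutes_in_image[of \<rho> "letters r n" "(i, 0)"] assms(2) jc by (simp add: colored_perms_def)
    then have j: "j \<in> {1..n}" and c: "c < r" by (auto simp: letters_def)
    have \<pi>: "\<pi> (j, b) = (m, (d + b) mod r)" if "b < r" for b
      using assms(1) j md that by (simp add: colored_perms_def)
    have "\<rho> (i, a) = (j, (c + a) mod r)"
      using assms(2) i jc a by (simp add: colored_perms_def)
    moreover have "k = m" "l = (d + c) mod r" using kl jc \<pi>[OF c] by auto
    moreover have "((d + c) mod r + a) mod r = (d + (c + a) mod r) mod r"
      by (simp add: mod_simps add.assoc)
    ultimately show ?thesis
      using \<pi>[of "(c + a) mod r"] a by simp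
  qed
  then show ?thesis
    using assms by (auto simp: colored_perms_def intro: permutes_compose)
qed

lemma colored_perms_inv:
  assumes "\<rho> \<in> colored_perms r n"
  shows "inv' \<rho> \<in> colored_perms r n"
proof -
  have p: "\<rho> permutes letters r n" using assms by (simp add: colored_perms_def)
  have "inv' \<rho> (k, a) = (i, (b + a) mod r)"
    if k: "k \<in> {1..n}" and ib: "inv' \<rho> (k, 0) = (i, b)" and a: "a < r" for k i b a
  proof -
    have "(k, 0) \<in> letters r n" using k a by (auto simp: letters_def)
    then have "(i, b) \<in> letters r n"
      using permutes_in_image[OF permutes_inv[OF p], of "(k, 0)"] ib by simp
    then have i: "i \<in> {1..n}" and b: "b < r" by (auto simp: letters_def)
    have eq: "\<rho> (i, b) = (k, 0)" using permutes_inverses(1)[OF p, of "(k, 0)"] ib by simp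
    obtain m l where ml: "\<rho> (i, 0) = (m, l)" by fastforce
    have \<rho>: "\<rho> (i, c) = (m, (l + c) mod r)" if "c < r" for c
      using assms i ml that by (simp add: colored_perms_def)
    have m: "m = k" and lb: "(l + b) mod r = 0" using \<rho>[OF b] eq by auto
    have "(l + (b + a) mod r) mod r = ((l + b) mod r + a) mod r"
      by (simp add: mod_simps add.assoc)
    then have "\<rho> (i, (b + a) mod r) = (k, a)"
      using \<rho>[of "(b + a) mod r"] a m lb by simp
    then show ?thesis using permutes_inverses(2)[OF p, of "(i, (b + a) mod r)"] by simp
  qed
  then show ?thesis using p by (auto simp: colored_perms_def permutes_inv)
qed

lemma colored_perm_group_is_group: "group (colored_perm_group r n)"
proof (rule groupI)
  fix \<rho> assume "\<rho> \<in> carrier (colored_perm_group r n)"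
  then have "inv' \<rho> \<in> colored_perms r n" "inv' \<rho> \<circ> \<rho> = id"
    by (auto simp: colored_perm_group_def colored_perms_inv)
      (auto simp: colored_perms_def dest: permutes_inv_o(2))
  then show "\<exists>\<pi>\<in>carrier (colored_perm_group r n). \<pi> \<otimes>\<^bsub>colored_perm_group r n\<^esub> \<rho> = \<one>\<^bsub>colored_perm_group r n\<^esub>"
    by (auto simp: colored_perm_group_def)
qed (auto simp: colored_perm_group_def colored_perms_comp comp_assoc,
     auto simp: colored_perms_def permutes_id)

lemma bij_fixing_permutes: "bij f \<Longrightarrow> (\<And>x. x \<notin> S \<Longrightarrow> f x = x) \<Longrightarrow> f permutes S"
  by (simp add: permutes_def bij_iff)

lemma forget_colors_iso:
  "forget_colors \<in> iso (colored_perm_group 1 n) (sym_group n)"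
proof -
  have fix0: "\<pi> (i, 0) = (forget_colors \<pi> i, 0)" if "\<pi> \<in> colored_perms 1 n" for \<pi> i
  proof (cases "i \<in> {1..n}")
    case True
    then have "\<pi> (i, 0) \<in> letters 1 n"
      using that by (auto simp: colored_perms_def letters_def permutes_in_image)
    then show ?thesis by (auto simp: forget_colors_def letters_def)
  next
    case False
    then have "\<pi> (i, 0) = (i, 0)"
      using that by (auto simp: colored_perms_def letters_def permutes_not_in)
    then show ?thesis by (simp add: forget_colors_def)
  qed
  have fixc: "\<pi> (i, c) = (i, c)" if "\<pi> \<in> colored_perms 1 n" "c \<noteq> 0" for \<pi> i c
    using that by (auto simp: colored_perms_def letters_def intro!: permutes_not_in)
  define up where "up \<sigma> = (\<lambda>(i, c :: nat). if c = 0 then (\<sigma> i, c) else (i, c))" for \<sigma> :: "nat \<Rightarrow> nat"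
  have perm: "forget_colors \<pi> permutes {1..n}" if "\<pi> \<in> colored_perms 1 n" for \<pi>
  proof (rule bij_fixing_permutes)
    have pp: "\<pi> permutes letters 1 n" using that by (simp add: colored_perms_def)
    show "bij (forget_colors \<pi>)"
    proof (rule bijI)
      show "inj (forget_colors \<pi>)"
        using permutes_inj[OF pp] fix0[OF that] by (metis injD injI prod.inject)
      show "surj (forget_colors \<pi>)"
      proof -
        have "\<exists>i. j = forget_colors \<pi> i" for j
        proof -
          obtain i c where ic: "\<pi> (i, c) = (j, 0)"
            using permutes_surj[OF pp] by (metis surj_def surj_pair)
          then have "c = 0" using fixc[OF that] by (metis prod.inject)
          then show ?thesis using ic fix0[OF that] by (metis prod.inject)
        qed
        then show ?thesis by (auto simp: surj_def)
      qed
    qed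
    show "\<And>i. i \<notin> {1..n} \<Longrightarrow> forget_colors \<pi> i = i"
      using permutes_not_in[OF pp] by (auto simp: forget_colors_def letters_def)
  qed
  have up: "up \<sigma> \<in> colored_perms 1 n" if s: "\<sigma> permutes {1..n}" for \<sigma>
  proof -
    have "up \<sigma> permutes letters 1 n"
    proof (rule bij_fixing_permutes)
      show "bij (up \<sigma>)"
      proof (rule o_bij)
        show "up (inv' \<sigma>) \<circ> up \<sigma> = id" "up \<sigma> \<circ> up (inv' \<sigma>) = id"
          by (auto simp: up_def fun_eq_iff permutes_inverses[OF s])
      qed
      show "\<And>x. x \<notin> letters 1 n \<Longrightarrow> up \<sigma> x = x"
        using s by (force simp: up_def letters_def permutes_def)
    qed
    then show ?thesis by (auto simp: colored_perms_def up_def)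
  qed
  have "bij_betw forget_colors (colored_perms 1 n) {\<sigma>. \<sigma> permutes {1..n}}"
  proof (rule bij_betw_byWitness[where f' = up])
    show "\<forall>\<pi>\<in>colored_perms 1 n. up (forget_colors \<pi>) = \<pi>"
    proof (intro ballI ext)
      fix \<pi> x assume "\<pi> \<in> colored_perms 1 n"
      then show "up (forget_colors \<pi>) x = \<pi> x"
        using fix0[of \<pi> "fst x"] fixc[of \<pi> "snd x" "fst x"] by (cases x) (auto simp: up_def)
    qed
    show "\<forall>\<sigma>\<in>{\<sigma>. \<sigma> permutes {1..n}}. forget_colors (up \<sigma>) = \<sigma>"
      by (auto simp: up_def forget_colors_def)
  qed (use perm up in auto)
  moreover have "forget_colors (\<pi> \<circ> \<rho>) = forget_colors \<pi> \<circ> forget_colors \<rho>"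
    if "\<pi> \<in> colored_perms 1 n" "\<rho> \<in> colored_perms 1 n" for \<pi> \<rho>
    using fix0[OF that(2)] by (auto simp: forget_colors_def fun_eq_iff)
  ultimately show ?thesis
    using perm by (auto simp: iso_def hom_def colored_perm_group_def sym_group_def)
qed

end

theory Submission imports Defs "HOL-Library.Infinite_Set"
begin

text \<open>Take \<open>x = rp + 1 = m\<close>. The coefficient of \<open>\<pi>\<close> in the generating function is then the number of
  maps \<open>f\<close> from \<open>{1..n}\<close> to \<open>{0..<m}\<close> that are sorted by \<open>\<pi>\<close>: the letters \<open>j\<close> of the word of \<open>\<pi>\<close> are
  ordered by \<open>f j\<close>, ties by \<open>j\<close>, and \<open>j\<close> has color \<open>f j mod r\<close>. If \<open>\<sigma>\<close> sorts \<open>f\<close> and \<open>\<tau>\<close> sorts \<open>g\<close>, then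
  \<open>\<sigma>\<tau>\<close> sorts \<open>l \<mapsto> g(\<bar>\<sigma>\<bar>\<^sup>-\<^sup>1 l) m + f l\<close>; the colors add up because \<open>m \<equiv> 1\<close> modulo \<open>r\<close>. As in the
  composition of riffle shuffles, this makes the generating function multiplicative at all \<open>rp + 1\<close>,
  hence identically, and comparing coefficients gives the orthogonal idempotents. Its values at
  \<open>rp + 1\<close> for \<open>p = 0, \<dots>, n\<close> are unitriangular in the \<open>C\<^sub>i\<close>, which gives the span.\<close>


subsection \<open>Weakly increasing sequences with prescribed strict ascents\<close>

text \<open>The sequences \<open>b 1, \<dots>, b n\<close> in \<open>{0..p}\<close>, with \<open>p\<close> appended at position \<open>n + 1\<close>.\<close>

definition chains :: "(nat \<Rightarrow> bool) \<Rightarrow> nat \<Rightarrow> nat \<Rightarrow> (nat \<Rightarrow> nat) set" where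
  "chains D n p = {b \<in> extensional {1..n}.
     \<forall>i\<in>{1..n}. b i + of_bool (D i) \<le> (b(Suc n := p)) (Suc i)}"

lemma chains_0: "chains D 0 p = {\<lambda>_. undefined}"
  by (auto simp: chains_def)

lemma chains_upd_iff:
  assumes "b \<in> extensional {1..n}"
  shows "b(Suc n := v) \<in> chains D (Suc n) p \<longleftrightarrow>
    b \<in> chains D n v \<and> v + of_bool (D (Suc n)) \<le> p"
proof -
  have "(\<forall>i\<in>{1..Suc n}. (b(Suc n := v)) i + of_bool (D i)
          \<le> (b(Suc n := v, Suc (Suc n) := p)) (Suc i)) \<longleftrightarrow>
        (\<forall>i\<in>{1..n}. b i + of_bool (D i) \<le> (b(Suc n := v)) (Suc i)) \<and>
        v + of_bool (D (Suc n)) \<le> p"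
    by (auto simp: atLeastAtMostSuc_conv)
  moreover have "b(Suc n := v) \<in> extensional {1..Suc n}"
    using assms by (auto simp: extensional_def)
  ultimately show ?thesis
    using assms by (simp add: chains_def)
qed

text \<open>The last value \<open>v\<close> has to respect the bound \<open>p\<close> and then
  serves as the bound for the first \<open>n\<close> values. This is the recursion behind the
  count.\<close>

lemma chains_Suc:
  "bij_betw (\<lambda>(v, b). b(Suc n := v))
     (SIGMA v:{v. v + of_bool (D (Suc n)) \<le> p}. chains D n v) (chains D (Suc n) p)"
proof (rule bij_betw_byWitness[where f' = "\<lambda>b. (b (Suc n), b(Suc n := undefined))"])
  have ext: "b \<in> extensional {1..n}" if "b \<in> chains D n v" for b v
    using that by (simp add: chains_def)
  have upd: "b(Suc n := undefined) = b" if "b \<in> chains D n v" for b v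
    using ext[OF that] by (intro fun_upd_idem) (simp add: extensional_def)
  then show "\<forall>a\<in>(SIGMA v:{v. v + of_bool (D (Suc n)) \<le> p}. chains D n v).
      ((case a of (v, b) \<Rightarrow> b(Suc n := v)) (Suc n),
       (case a of (v, b) \<Rightarrow> b(Suc n := v))(Suc n := undefined)) = a"
    by clarsimp
  show "\<forall>a\<in>chains D (Suc n) p. (\<lambda>(v, b). b(Suc n := v)) (a (Suc n), a(Suc n := undefined)) = a"
    by auto
  show "(\<lambda>(v, b). b(Suc n := v)) ` (SIGMA v:{v. v + of_bool (D (Suc n)) \<le> p}. chains D n v)
      \<subseteq> chains D (Suc n) p"
    using ext by (auto simp: chains_upd_iff simp del: fun_upd_apply)
  show "(\<lambda>b. (b (Suc n), b(Suc n := undefined))) ` chains D (Suc n) p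
      \<subseteq> (SIGMA v:{v. v + of_bool (D (Suc n)) \<le> p}. chains D n v)"
  proof (rule image_subsetI)
    fix b assume b: "b \<in> chains D (Suc n) p"
    then have "b(Suc n := undefined) \<in> extensional {1..n}"
      by (auto simp: chains_def extensional_def)
    from chains_upd_iff[OF this, of "b (Suc n)" D p] b
    show "(b (Suc n), b(Suc n := undefined)) \<in> (SIGMA v:{v. v + of_bool (D (Suc n)) \<le> p}. chains D n v)"
      by simp
  qed
qed

text \<open>The hockey-stick identity: the terms with \<open>v < d\<close> vanish, and
  \<open>d \<le> n\<close> keeps every subtraction from truncating.\<close>

lemma sum_choose_shift:
  assumes "d \<le> n"
  shows "(\<Sum>v\<le>p. (v + n - d) choose n) = (Suc p + n - d) choose Suc n"
proof (induction p)
  case 0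
  show ?case using assms by (cases "d = 0") (auto simp: binomial_eq_0)
next
  case (Suc p)
  have "Suc (Suc p) + n - d = Suc (Suc p + n - d)" using assms by simp
  then show ?case using Suc by simp
qed

text \<open>Subtracting from \<open>b i\<close> the number of forced strict ascents before
  \<open>i\<close> leaves a weakly increasing sequence bounded by \<open>p\<close> minus their total
  number, hence a multiset count. The induction reaches the same number by summing over the last
  value.\<close>

lemma finite_card_chains:
  "finite (chains D n p) \<and> card (chains D n p) = (p + n - card {i\<in>{1..n}. D i}) choose n"
proof (induction n arbitrary: p)
  case 0
  show ?case by (simp add: chains_0)
next
  case (Suc n)
  define d where "d = card {i\<in>{1..n}. D i}"
  have d: "d \<le> n" using card_mono[of "{1..n}" "{i\<in>{1..n}. D i}"] unfolding d_def by fastforce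
  have dS: "card {i\<in>{1..Suc n}. D i} = d + of_bool (D (Suc n))"
  proof -
    have "{i\<in>{1..Suc n}. D i} = (if D (Suc n) then insert (Suc n) {i\<in>{1..n}. D i} else {i\<in>{1..n}. D i})"
      by (auto simp: le_Suc_eq)
    then show ?thesis by (auto simp: d_def)
  qed
  let ?V = "{v. v + of_bool (D (Suc n)) \<le> p}"
  have finV: "finite ?V" by (rule finite_subset[of _ "{..p}"]) auto
  have fin: "finite (SIGMA v:?V. chains D n v)" using finV Suc.IH by blast
  have "card (chains D (Suc n) p) = card (SIGMA v:?V. chains D n v)"
    using bij_betw_same_card[OF chains_Suc] by (rule sym)
  also have "\<dots> = (\<Sum>v\<in>?V. (v + n - d) choose n)"
    using Suc.IH finV by (simp add: d_def)
  also have "\<dots> = (p + Suc n - (d + of_bool (D (Suc n)))) choose Suc n"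
  proof (cases "D (Suc n)")
    case False
    then have "?V = {..p}" by auto
    then show ?thesis using False sum_choose_shift[OF d, of p] by simp
  next
    case True
    show ?thesis
    \<comment> \<open>A strict ascent at the end restricts \<open>v\<close> to values below
      \<open>p\<close>. For \<open>p = 0\<close> none is left, and the binomial coefficient vanishes
      as well.\<close>
    proof (cases p)
      case 0
      then have "?V = {}" using True by auto
      then show ?thesis using True 0 d by (simp add: binomial_eq_0)
    next
      case (Suc q)
      then have "?V = {..q}" using True by auto
      then show ?thesis using True Suc sum_choose_shift[OF d, of q] by simp
    qed
  qed
  finally show ?case
    using fin bij_betw_finite[OF chains_Suc[of n D p]] dS by simp
qed

subsection \<open>Colored permutations as words\<close>

lemma colored_perm_apply:
  assumes "\<pi> \<in> colored_perms r n" "i \<in> {1..n}" "a < r"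
  shows "\<pi> (i, a) = (forget_colors \<pi> i, (snd (\<pi> (i, 0)) + a) mod r)"
  using assms by (cases "\<pi> (i, 0)") (simp add: colored_perms_def forget_colors_def)

lemma colored_perm_in_letters:
  assumes "\<pi> \<in> colored_perms r n" "r \<ge> 1" "i \<in> {1..n}"
  shows "forget_colors \<pi> i \<in> {1..n}" "snd (\<pi> (i, 0)) < r"
proof -
  have "\<pi> (i, 0) \<in> letters r n"
    using assms by (simp add: colored_perms_def letters_def permutes_in_image)
  then show "forget_colors \<pi> i \<in> {1..n}" "snd (\<pi> (i, 0)) < r"
    by (auto simp: letters_def forget_colors_def)
qed

text \<open>If two positions carried the same letter up to color, a color shift at one of them would
  give both the same image, against injectivity of \<open>\<pi>\<close>.\<close>

lemma forget_colors_bij: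
  assumes "\<pi> \<in> colored_perms r n" "r \<ge> 1"
  shows "bij_betw (forget_colors \<pi>) {1..n} {1..n}"
proof (rule bij_betw_imageI)
  show inj: "inj_on (forget_colors \<pi>) {1..n}"
  proof (rule inj_onI)
    fix i j assume ij: "i \<in> {1..n}" "j \<in> {1..n}" and eq: "forget_colors \<pi> i = forget_colors \<pi> j"
    define c d where "c = snd (\<pi> (i, 0))" and "d = snd (\<pi> (j, 0))"
    \<comment> \<open>The color shift \<open>d - c\<close> modulo \<open>r\<close>, written with
      \<open>r - c\<close> to stay within the natural numbers.\<close>
    define a where "a = (d + (r - c)) mod r"
    have cd: "c < r" "d < r" using colored_perm_in_letters[OF assms] ij by (auto simp: c_def d_def)
    have "(c + a) mod r = (c + (d + (r - c))) mod r" by (simp add: a_def mod_simps)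
    also have "\<dots> = d" using cd by simp
    finally have "\<pi> (i, a) = (forget_colors \<pi> j, d)"
      using colored_perm_apply[OF assms(1) ij(1), of a] assms(2) eq by (simp add: a_def c_def)
    also have "\<dots> = \<pi> (j, 0)" by (simp add: forget_colors_def d_def)
    finally have "(i, a) = (j, 0)"
      using assms(1) by (auto simp: colored_perms_def dest: permutes_inj injD)
    then show "i = j" by simp
  qed
  show "forget_colors \<pi> ` {1..n} = {1..n}"
    using colored_perm_in_letters(1)[OF assms] inj by (intro endo_inj_surj) auto
qed

lemma colored_perms_eqI:
  assumes "\<pi> \<in> colored_perms r n" "\<rho> \<in> colored_perms r n"
    and "\<And>i. i \<in> {1..n} \<Longrightarrow> \<pi> (i, 0) = \<rho> (i, 0)"
  shows "\<pi> = \<rho>"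
proof
  fix x :: letter
  obtain i a where x: "x = (i, a)" by fastforce
  show "\<pi> x = \<rho> x"
  proof (cases "x \<in> letters r n")
    case True
    then have ia: "i \<in> {1..n}" "a < r" by (auto simp: x letters_def)
    then show ?thesis
      using colored_perm_apply[OF assms(1) ia] colored_perm_apply[OF assms(2) ia] assms(3)[OF ia(1)]
      by (simp add: x forget_colors_def)
  next
    case False
    then have "\<pi> x = x" "\<rho> x = x"
      using assms(1,2) unfolding colored_perms_def by (blast intro: permutes_not_in)+
    then show ?thesis by simp
  qed
qed

lemma colored_perms_from_word:
  assumes s: "bij_betw s {1..n} {1..n}" and c: "\<And>i. i \<in> {1..n} \<Longrightarrow> c i < r"
  obtains \<pi> where "\<pi> \<in> colored_perms r n" "\<And>i. i \<in> {1..n} \<Longrightarrow> \<pi> (i, 0) = (s i, c i)"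
proof
  define \<pi> where "\<pi> = (\<lambda>(i, a). if (i, a) \<in> letters r n then (s i, (c i + a) mod r) else (i, a))"
  have sim: "s i \<in> {1..n}" if "i \<in> {1..n}" for i using s that bij_betwE by blast
  have finite_letters: "finite (letters r n)" by (simp add: letters_def)
  have im: "\<pi> x \<in> letters r n" if "x \<in> letters r n" for x
    using that sim by (fastforce simp: \<pi>_def letters_def)
  have inj: "inj_on \<pi> (letters r n)"
  proof (rule inj_onI)
    fix x y assume xy: "x \<in> letters r n" "y \<in> letters r n" "\<pi> x = \<pi> y"
    obtain i a j b where ij: "x = (i, a)" "y = (j, b)" by fastforce
    have "i \<in> {1..n}" "j \<in> {1..n}" "a < r" "b < r" using xy(1,2) ij by (auto simp: letters_def)
    moreover have "s i = s j" "(c i + a) mod r = (c j + b) mod r" using xy ij by (auto simp: \<pi>_def)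
    ultimately have "i = j" using s by (auto simp: bij_betw_def dest: inj_onD)
    \<comment> \<open>Adding \<open>r - c i\<close> on both sides cancels the color
      \<open>c i\<close> modulo \<open>r\<close>.\<close>
    have "((c i + a) mod r + (r - c i)) mod r = ((c i + b) mod r + (r - c i)) mod r"
      using \<open>i = j\<close> \<open>(c i + a) mod r = (c j + b) mod r\<close> by simp
    then have "(c i + a + (r - c i)) mod r = (c i + b + (r - c i)) mod r" by (simp only: mod_add_left_eq)
    then have "a mod r = b mod r" using c[OF \<open>i \<in> {1..n}\<close>] by simp
    then show "x = y" using \<open>i = j\<close> \<open>a < r\<close> \<open>b < r\<close> ij by simp
  qed
  have "\<pi> permutes letters r n"
  proof (rule bij_imp_permutes)
    show "bij_betw \<pi> (letters r n) (letters r n)"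
      using im inj finite_letters by (intro bij_betw_imageI endo_inj_surj) auto
    show "\<And>x. x \<notin> letters r n \<Longrightarrow> \<pi> x = x" by (auto simp: \<pi>_def split: prod.splits)
  qed
  moreover have app: "\<pi> (i, a) = (s i, (c i + a) mod r)" if "i \<in> {1..n}" "a < r" for i a
    using that by (simp add: \<pi>_def letters_def)
  moreover show app0: "\<pi> (i, 0) = (s i, c i)" if "i \<in> {1..n}" for i
    using app[OF that, of 0] c[OF that] by simp
  ultimately show "\<pi> \<in> colored_perms r n"
    unfolding colored_perms_def by simp
qed

lemma finite_colored_perms: "finite (colored_perms r n)"
  by (rule finite_subset[OF _ finite_permutations[of "letters r n"]])
    (auto simp: colored_perms_def letters_def)


subsection \<open>Sorting functions to colored permutations\<close>

text \<open>Encodes the lexicographic order on the pairs \<open>(f j, j)\<close>, for \<open>j \<le> n\<close>.\<close>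

definition rank_key :: "nat \<Rightarrow> (nat \<Rightarrow> nat) \<Rightarrow> nat \<Rightarrow> nat" where
  "rank_key n f j = f j * Suc n + j"

text \<open>Two-digit numbers in base \<open>m\<close> compare lexicographically. The lemma serves
  three encodings: ranks in base \<open>Suc n\<close>, values \<open>b i * r + c\<close> with color
  digit \<open>c\<close>, and pairs of functions in base \<open>m\<close>.\<close>

lemma mult_add_less_iff:
  fixes a b c d m :: nat
  assumes "b < m" "d < m"
  shows "a * m + b < c * m + d \<longleftrightarrow> a < c \<or> a = c \<and> b < d"
proof -
  have *: "a * m + b < c * m + d" if "a < c" "b < m" for a b c d :: nat
  proof -
    have "Suc a * m \<le> c * m" using that by (intro mult_le_mono1) simp
    then show ?thesis using that by simp
  qed
  show ?thesis
  proof (cases a c rule: linorder_cases)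
    case less
    then show ?thesis using *[OF less assms(1)] by simp
  next
    case greater
    then show ?thesis using *[OF greater assms(2), of b] by simp
  qed simp
qed

lemma rank_key_less_iff:
  "j \<le> n \<Longrightarrow> k \<le> n \<Longrightarrow> rank_key n f j < rank_key n f k \<longleftrightarrow> f j < f k \<or> f j = f k \<and> j < k"
  unfolding rank_key_def by (rule mult_add_less_iff) auto

lemma inj_on_rank_key: "inj_on (rank_key n f) {1..n}"
proof (rule inj_onI)
  fix j k assume jk: "j \<in> {1..n}" "k \<in> {1..n}" and eq: "rank_key n f j = rank_key n f k"
  have *: "rank_key n f i mod Suc n = i" if "i \<le> n" for i
    unfolding rank_key_def mod_mult_self3 using that by (rule mod_less[OF le_imp_less_Suc])
  show "j = k" using *[of j] *[of k] jk unfolding eq by (metis atLeastAtMost_iff)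
qed

text \<open>Strictly increasing keys express a stable sort: letters with equal values of
  \<open>f\<close> appear in their natural order.\<close>

definition sorts :: "nat \<Rightarrow> nat \<Rightarrow> (nat \<Rightarrow> nat) \<Rightarrow> (letter \<Rightarrow> letter) \<Rightarrow> bool" where
  "sorts r n f \<pi> \<longleftrightarrow> (\<forall>i\<in>{1..n}. snd (\<pi> (i, 0)) = f (forget_colors \<pi> i) mod r) \<and>
     strict_mono_on {1..n} (\<lambda>i. rank_key n f (forget_colors \<pi> i))"

lemma ex_strict_mono_enumeration:
  fixes key :: "nat \<Rightarrow> nat"
  assumes "inj_on key {1..n}"
  obtains s where "bij_betw s {1..n} {1..n}" "strict_mono_on {1..n} (\<lambda>i. key (s i))"
proof -
  have card: "card (key ` {1..n}) = n" using assms by (simp add: card_image)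
  obtain h where h: "bij_betw h {..<n} (key ` {1..n})" "strict_mono_on {..<n} h"
    by (rule ex_bij_betw_strict_mono_card[OF finite_imageI[OF finite_atLeastAtMost], of key 1 n, unfolded card])
  \<comment> \<open>\<open>h\<close> lists the keys in increasing order from index 0;
    \<open>s\<close> shifts the index to start at 1 and returns from keys to elements.\<close>
  define s where "s = inv_into {1..n} key \<circ> (h \<circ> (\<lambda>i. i - 1))"
  have pre: "bij_betw (\<lambda>i. i - 1) {1..n} {..<n}"
    by (rule bij_betw_byWitness[where f' = Suc]) auto
  have hpre: "bij_betw (h \<circ> (\<lambda>i. i - 1)) {1..n} (key ` {1..n})"
    by (rule bij_betw_trans[OF pre h(1)])
  have bij_s: "bij_betw s {1..n} {1..n}"
    unfolding s_def
    by (rule bij_betw_trans[OF hpre bij_betw_inv_into[OF inj_on_imp_bij_betw[OF assms]]])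
  have key_s: "key (s i) = h (i - 1)" if "i \<in> {1..n}" for i
    using bij_betwE[OF hpre] that by (simp add: s_def f_inv_into_f)
  have "strict_mono_on {1..n} (\<lambda>i. key (s i))"
  proof (rule strict_mono_onI)
    fix i j assume "i \<in> {1..n}" "j \<in> {1..n}" "i < j"
    then show "key (s i) < key (s j)"
      unfolding key_s[OF \<open>i \<in> {1..n}\<close>] key_s[OF \<open>j \<in> {1..n}\<close>]
      by (intro strict_mono_onD[OF h(2)]) auto
  qed
  then show ?thesis by (rule that[OF bij_s])
qed

text \<open>The position of an element is recovered from its key alone, independently of
  \<open>s\<close>. Uniqueness of the enumeration follows from this.\<close>

lemma strict_mono_enumeration_index:
  fixes key :: "nat \<Rightarrow> nat"
  assumes s: "bij_betw s {1..n} {1..n}" "strict_mono_on {1..n} (\<lambda>i. key (s i))"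
    and i: "i \<in> {1..n}"
  shows "card {j\<in>{1..n}. key j \<le> key (s i)} = i"
proof -
  have *: "key (s k) \<le> key (s i) \<longleftrightarrow> k \<le> i" if "k \<in> {1..n}" for k
    using strict_mono_on_less[OF s(2) i that] by (simp add: not_less[symmetric])
  have "{j\<in>{1..n}. key j \<le> key (s i)} = s ` {1..i}"
  proof (intro equalityI subsetI)
    fix j assume j: "j \<in> {j\<in>{1..n}. key j \<le> key (s i)}"
    then have "j \<in> s ` {1..n}" using s(1) by (simp add: bij_betw_def)
    then obtain k where "k \<in> {1..n}" "j = s k" by blast
    then show "j \<in> s ` {1..i}" using j * by auto
  next
    fix j assume "j \<in> s ` {1..i}"
    then obtain k where k: "k \<in> {1..i}" "j = s k" by auto
    then have "k \<in> {1..n}" using i by auto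
    then show "j \<in> {j\<in>{1..n}. key j \<le> key (s i)}"
      using k * s(1) by (auto dest: bij_betwE)
  qed
  moreover have "inj_on s {1..i}"
    using i by (intro inj_on_subset[OF bij_betw_imp_inj_on[OF s(1)]]) auto
  ultimately show ?thesis by (simp add: card_image)
qed

lemma strict_mono_enumeration_unique:
  fixes key :: "nat \<Rightarrow> nat"
  assumes s: "bij_betw s {1..n} {1..n}" "strict_mono_on {1..n} (\<lambda>i. key (s i))"
    and t: "bij_betw t {1..n} {1..n}" "strict_mono_on {1..n} (\<lambda>i. key (t i))"
    and i: "i \<in> {1..n}"
  shows "s i = t i"
proof -
  have "s i \<in> t ` {1..n}" using s(1) t(1) i by (auto simp: bij_betw_def)
  then obtain k where k: "k \<in> {1..n}" "s i = t k" by auto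
  then have "i = k"
    using strict_mono_enumeration_index[OF s i] strict_mono_enumeration_index[OF t k(1)] by simp
  then show ?thesis using k by simp
qed

text \<open>The uncolored word is the unique increasing enumeration by \<open>rank_key\<close>, and
  the colors are then dictated by \<open>f\<close>; a colored permutation is determined by its
  word.\<close>

lemma ex1_sorts:
  assumes "r \<ge> 1"
  shows "\<exists>!\<pi>. \<pi> \<in> colored_perms r n \<and> sorts r n f \<pi>"
proof (rule ex_ex1I)
  obtain s where s: "bij_betw s {1..n} {1..n}" "strict_mono_on {1..n} (\<lambda>i. rank_key n f (s i))"
    using ex_strict_mono_enumeration[OF inj_on_rank_key] by blast
  obtain \<pi> where \<pi>: "\<pi> \<in> colored_perms r n"
      and w: "\<And>i. i \<in> {1..n} \<Longrightarrow> \<pi> (i, 0) = (s i, f (s i) mod r)"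
    using colored_perms_from_word[OF s(1), of "\<lambda>i. f (s i) mod r" r] assms by auto
  have "sorts r n f \<pi>"
    using s(2) w by (auto simp: sorts_def forget_colors_def strict_mono_on_def)
  then show "\<exists>\<pi>. \<pi> \<in> colored_perms r n \<and> sorts r n f \<pi>" using \<pi> by blast
next
  fix \<pi> \<rho>
  assume \<pi>: "\<pi> \<in> colored_perms r n \<and> sorts r n f \<pi>"
    and \<rho>: "\<rho> \<in> colored_perms r n \<and> sorts r n f \<rho>"
  have "forget_colors \<pi> i = forget_colors \<rho> i" if "i \<in> {1..n}" for i
    using strict_mono_enumeration_unique[where key = "rank_key n f" and n = n]
      forget_colors_bij[OF _ assms] \<pi> \<rho> that
    unfolding sorts_def by blast
  then have "\<pi> (i, 0) = \<rho> (i, 0)" if "i \<in> {1..n}" for i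
    using that \<pi> \<rho> by (auto simp: sorts_def forget_colors_def prod_eq_iff)
  then show "\<pi> = \<rho>" using colored_perms_eqI \<pi> \<rho> by blast
qed

definition sorting_perm :: "nat \<Rightarrow> nat \<Rightarrow> (nat \<Rightarrow> nat) \<Rightarrow> letter \<Rightarrow> letter" where
  "sorting_perm r n f = (THE \<pi>. \<pi> \<in> colored_perms r n \<and> sorts r n f \<pi>)"

lemma sorting_perm:
  assumes "r \<ge> 1"
  shows "sorting_perm r n f \<in> colored_perms r n" "sorts r n f (sorting_perm r n f)"
  using theI'[OF ex1_sorts[OF assms]] unfolding sorting_perm_def by blast+

lemma sorting_perm_eq_iff:
  assumes "r \<ge> 1" "\<pi> \<in> colored_perms r n"
  shows "sorting_perm r n f = \<pi> \<longleftrightarrow> sorts r n f \<pi>"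
  using ex1_sorts[OF assms(1), of n f] sorting_perm[OF assms(1), of n f] assms(2) by blast

text \<open>In base \<open>m\<close>, \<open>h\<close> has high digit \<open>g\<close> and low digit
  \<open>f\<close>, so sorting by \<open>h\<close> means sorting by \<open>g\<close> and breaking
  ties by \<open>f\<close>. Stating \<open>h\<close> at \<open>forget_colors \<sigma> k\<close>
  avoids the inverse of \<sigma>.\<close>

lemma sorts_comp:
  assumes r: "r \<ge> 1" and m: "m mod r = 1 mod r"
    and \<sigma>: "\<sigma> \<in> colored_perms r n" "sorts r n f \<sigma>"
    and \<tau>: "\<tau> \<in> colored_perms r n" "sorts r n g \<tau>"
    and f: "\<And>l. l \<in> {1..n} \<Longrightarrow> f l < m"
    and h: "\<And>k. k \<in> {1..n} \<Longrightarrow> h (forget_colors \<sigma> k) = g k * m + f (forget_colors \<sigma> k)"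
  shows "sorts r n h (\<sigma> \<circ> \<tau>)"
proof -
  have w: "(\<sigma> \<circ> \<tau>) (i, 0) = (forget_colors \<sigma> (forget_colors \<tau> i),
      (snd (\<sigma> (forget_colors \<tau> i, 0)) + snd (\<tau> (i, 0))) mod r)" if i: "i \<in> {1..n}" for i
  proof -
    have "(\<sigma> \<circ> \<tau>) (i, 0) = \<sigma> (forget_colors \<tau> i, snd (\<tau> (i, 0)))"
      by (simp add: forget_colors_def)
    also have "\<dots> = (forget_colors \<sigma> (forget_colors \<tau> i),
        (snd (\<sigma> (forget_colors \<tau> i, 0)) + snd (\<tau> (i, 0))) mod r)"
      by (rule colored_perm_apply[OF \<sigma>(1) colored_perm_in_letters[OF \<tau>(1) r i]])
    finally show ?thesis .
  qed
  have fc: "forget_colors (\<sigma> \<circ> \<tau>) i = forget_colors \<sigma> (forget_colors \<tau> i)" if "i \<in> {1..n}" for i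
    using w[OF that] by (simp add: forget_colors_def)
  have "snd ((\<sigma> \<circ> \<tau>) (i, 0)) = h (forget_colors (\<sigma> \<circ> \<tau>) i) mod r" if i: "i \<in> {1..n}" for i
  proof -
    let ?k = "forget_colors \<tau> i"
    have k: "?k \<in> {1..n}" using colored_perm_in_letters[OF \<tau>(1) r i] by simp
    have "snd ((\<sigma> \<circ> \<tau>) (i, 0)) = (f (forget_colors \<sigma> ?k) mod r + g ?k mod r) mod r"
      using w[OF i] \<sigma>(2) \<tau>(2) i k by (simp add: sorts_def)
    \<comment> \<open>The factor \<open>1 mod r\<close> is kept unreduced, since it is 0 for
      \<open>r = 1\<close>; the hypothesis on \<open>m\<close> then replaces it by
      \<open>m mod r\<close>.\<close>
    also have "\<dots> = (g ?k * (1 mod r) + f (forget_colors \<sigma> ?k)) mod r"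
      by (simp add: mod_simps add.commute)
    also have "\<dots> = h (forget_colors (\<sigma> \<circ> \<tau>) i) mod r"
      unfolding fc[OF i] h[OF k] m[symmetric] by (metis mod_add_left_eq mod_mult_right_eq)
    finally show ?thesis .
  qed
  moreover have "strict_mono_on {1..n} (\<lambda>i. rank_key n h (forget_colors (\<sigma> \<circ> \<tau>) i))"
  proof (rule strict_mono_onI)
    fix i j assume i: "i \<in> {1..n}" and j: "j \<in> {1..n}" and "i < j"
    let ?k = "forget_colors \<tau> i" and ?l = "forget_colors \<tau> j"
    let ?k' = "forget_colors \<sigma> ?k" and ?l' = "forget_colors \<sigma> ?l"
    have kl: "?k \<in> {1..n}" "?l \<in> {1..n}" using colored_perm_in_letters[OF \<tau>(1) r] i j by auto
    then have kl': "?k' \<in> {1..n}" "?l' \<in> {1..n}" using colored_perm_in_letters[OF \<sigma>(1) r] by auto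
    have "rank_key n g ?k < rank_key n g ?l"
      using \<tau>(2) i j \<open>i < j\<close> by (auto simp: sorts_def strict_mono_on_def)
    then have "g ?k < g ?l \<or> g ?k = g ?l \<and> ?k < ?l" using kl by (simp add: rank_key_less_iff)
    \<comment> \<open>A tie in \<open>g\<close> is broken by \<open>?k < ?l\<close>, and these are
      positions in the word of \<sigma>, which is sorted by \<open>f\<close>.\<close>
    moreover have "rank_key n f ?k' < rank_key n f ?l'" if "?k < ?l"
      using \<sigma>(2) kl that unfolding sorts_def strict_mono_on_def by blast
    then have "f ?k' < f ?l' \<or> f ?k' = f ?l' \<and> ?k' < ?l'" if "?k < ?l"
      using that kl' by (simp add: rank_key_less_iff)
    ultimately have "h ?k' < h ?l' \<or> h ?k' = h ?l' \<and> ?k' < ?l'"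
      using mult_add_less_iff[OF f[OF kl'(1)] f[OF kl'(2)]] by (auto simp: h[OF kl(1)] h[OF kl(2)])
    then show "rank_key n h (forget_colors (\<sigma> \<circ> \<tau>) i) < rank_key n h (forget_colors (\<sigma> \<circ> \<tau>) j)"
      unfolding fc[OF i] fc[OF j] using kl' by (simp add: rank_key_less_iff)
  qed
  ultimately show ?thesis by (simp add: sorts_def)
qed

subsection \<open>Counting the functions sorted by a colored permutation\<close>

text \<open>Comparing only neighbors brings the sorting condition into the form of the inequalities
  that define \<open>chains\<close>.\<close>

lemma sorts_adjacent_iff:
  "sorts r n f \<pi> \<longleftrightarrow> (\<forall>i\<in>{1..n}. snd (\<pi> (i, 0)) = f (forget_colors \<pi> i) mod r) \<and>
     (\<forall>i\<in>{1..<n}. rank_key n f (forget_colors \<pi> i) < rank_key n f (forget_colors \<pi> (Suc i)))"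
proof -
  have "strict_mono_on {1..n} u \<longleftrightarrow> (\<forall>i\<in>{1..<n}. u i < u (Suc i))" for u :: "nat \<Rightarrow> nat"
  proof
    assume *: "\<forall>i\<in>{1..<n}. u i < u (Suc i)"
    have "u i < u j" if "i < j" "i \<in> {1..n}" "j \<in> {1..n}" for i j
      using that
    proof (induction j)
      case (Suc j)
      then show ?case using * by (cases "i = j") (auto dest!: bspec[of _ _ j])
    qed simp
    then show "strict_mono_on {1..n} u" by (simp add: strict_mono_on_def)
  qed (auto simp: strict_mono_on_def)
  then show ?thesis by (simp add: sorts_def)
qed


text \<open>The keys compare first by \<open>b\<close>, then by color, then by letter. The last two
  comparisons are the order of colored letters, so \<open>b\<close> may stay constant exactly where
  the word has no descent.\<close>

lemma rank_key_adjacent_iff: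
  assumes r: "r \<ge> 1" and \<pi>: "\<pi> \<in> colored_perms r n"
    and f: "\<And>i. i \<in> {1..n} \<Longrightarrow> f (forget_colors \<pi> i) = b i * r + snd (\<pi> (i, 0))"
    and i: "i \<in> {1..<n}"
  shows "rank_key n f (forget_colors \<pi> i) < rank_key n f (forget_colors \<pi> (Suc i)) \<longleftrightarrow>
    b i + of_bool (letter_less (word n \<pi> (i + 1)) (word n \<pi> i)) \<le> b (Suc i)"
proof -
  let ?s = "forget_colors \<pi>" and ?c = "\<lambda>i. snd (\<pi> (i, 0))"
  have ii: "i \<in> {1..n}" "Suc i \<in> {1..n}" using i by auto
  have c: "?c i < r" "?c (Suc i) < r" using colored_perm_in_letters[OF \<pi> r] ii by auto
  have s: "?s i \<in> {1..n}" "?s (Suc i) \<in> {1..n}" using colored_perm_in_letters[OF \<pi> r] ii by auto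
  have "inj_on ?s {1..n}" using forget_colors_bij[OF \<pi> r] by (rule bij_betw_imp_inj_on)
  \<comment> \<open>As neighboring letters differ, the absence of a descent is a strict
    ascent.\<close>
  then have ne: "?s i \<noteq> ?s (Suc i)" using ii by (auto dest: inj_onD)
  have less: "f (?s i) < f (?s (Suc i)) \<longleftrightarrow> b i < b (Suc i) \<or> b i = b (Suc i) \<and> ?c i < ?c (Suc i)"
    unfolding f[OF ii(1)] f[OF ii(2)] by (rule mult_add_less_iff[OF c])
  have less': "f (?s (Suc i)) < f (?s i) \<longleftrightarrow> b (Suc i) < b i \<or> b (Suc i) = b i \<and> ?c (Suc i) < ?c i"
    unfolding f[OF ii(1)] f[OF ii(2)] by (rule mult_add_less_iff[OF c(2) c(1)])
  have w: "word n \<pi> (i + 1) = (?s (Suc i), ?c (Suc i))" "word n \<pi> i = (?s i, ?c i)"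
    using i by (auto simp: word_def forget_colors_def)
  have "rank_key n f (?s i) < rank_key n f (?s (Suc i)) \<longleftrightarrow>
      f (?s i) < f (?s (Suc i)) \<or> \<not> f (?s (Suc i)) < f (?s i) \<and> ?s i < ?s (Suc i)"
    using s by (auto simp: rank_key_less_iff)
  also have "\<dots> \<longleftrightarrow> b i < b (Suc i) \<or>
      b i = b (Suc i) \<and> (?c i < ?c (Suc i) \<or> ?c i = ?c (Suc i) \<and> ?s i < ?s (Suc i))"
    unfolding less less' by (cases "b i" "b (Suc i)" rule: linorder_cases) auto
  also have "\<dots> \<longleftrightarrow> b i < b (Suc i) \<or> b i = b (Suc i) \<and> \<not> letter_less (word n \<pi> (i + 1)) (word n \<pi> i)"
    unfolding w letter_less_def fst_conv snd_conv using ne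
    by (cases "?c i" "?c (Suc i)" rule: linorder_cases;
        cases "?s i" "?s (Suc i)" rule: linorder_cases) simp_all
  also have "\<dots> \<longleftrightarrow> b i + of_bool (letter_less (word n \<pi> (i + 1)) (word n \<pi> i)) \<le> b (Suc i)"
    by auto
  finally show ?thesis .
qed

text \<open>With the color as remainder modulo \<open>r\<close>, the free part of \<open>f\<close>
  is its quotient \<open>b\<close>. Inner descents come from the sorting condition, and the descent
  at \<open>n\<close> from the bound on the values of \<open>f\<close>.\<close>

lemma sorts_iff_chains:
  assumes r: "r \<ge> 1" and \<pi>: "\<pi> \<in> colored_perms r n"
    and f: "\<And>i. i \<in> {1..n} \<Longrightarrow> f (forget_colors \<pi> i) = b i * r + snd (\<pi> (i, 0))"
    and ext: "f \<in> extensional {1..n}" "b \<in> extensional {1..n}"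
  shows "f \<in> {1..n} \<rightarrow>\<^sub>E {..<Suc (p * r)} \<and> sorts r n f \<pi> \<longleftrightarrow>
    b \<in> chains (\<lambda>i. letter_less (word n \<pi> (i + 1)) (word n \<pi> i)) n p"
proof -
  let ?s = "forget_colors \<pi>" and ?c = "\<lambda>i. snd (\<pi> (i, 0))"
  let ?D = "\<lambda>i. letter_less (word n \<pi> (i + 1)) (word n \<pi> i)"
  note adj = rank_key_adjacent_iff[OF r \<pi> f]
  have col: "\<forall>i\<in>{1..n}. ?c i = f (?s i) mod r"
    using f colored_perm_in_letters(2)[OF \<pi> r] by simp
  have sorts: "sorts r n f \<pi> \<longleftrightarrow> (\<forall>i\<in>{1..<n}. b i + of_bool (?D i) \<le> b (Suc i))"
    unfolding sorts_adjacent_iff using col adj by simp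
  \<comment> \<open>The bound reads \<open>b n * r + ?c n \<le> p * r\<close>: the value
    \<open>b n = p\<close> is allowed only with color 0. This is the convention that appends
    \<open>(0, 1)\<close> to the word, since letters are positive.\<close>
  have last: "f (?s n) < Suc (p * r) \<longleftrightarrow> b n + of_bool (?D n) \<le> p" if "n \<ge> 1"
  proof -
    have n: "n \<in> {1..n}" using that by simp
    have c: "?c n < r" and s: "?s n \<in> {1..n}" using colored_perm_in_letters[OF \<pi> r n] by auto
    have "p * r < b n * r + ?c n \<longleftrightarrow> p < b n \<or> p = b n \<and> 0 < ?c n"
      using mult_add_less_iff[of 0 r "?c n" p "b n"] r c by simp
    moreover have "f (?s n) < Suc (p * r) \<longleftrightarrow> \<not> p * r < b n * r + ?c n"
      unfolding f[OF n] by linarith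
    ultimately have *: "f (?s n) < Suc (p * r) \<longleftrightarrow> b n < p \<or> b n = p \<and> ?c n = 0"
      by (cases p "b n" rule: linorder_cases) simp_all
    have w: "word n \<pi> (n + 1) = (0, 1)" "word n \<pi> n = (?s n, ?c n)"
      by (auto simp: word_def forget_colors_def)
    show ?thesis
      unfolding * w letter_less_def using s by auto
  qed
  have chains: "b \<in> chains ?D n p \<longleftrightarrow>
      (\<forall>i\<in>{1..<n}. b i + of_bool (?D i) \<le> b (Suc i)) \<and> (n \<ge> 1 \<longrightarrow> b n + of_bool (?D n) \<le> p)"
  proof (cases "n \<ge> 1")
    case True
    then have "{1..n} = insert n {1..<n}" by auto
    then show ?thesis using ext(2) True by (auto simp: chains_def)
  qed (use ext(2) in \<open>auto simp: chains_def\<close>)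
  show ?thesis
  proof
    assume "f \<in> {1..n} \<rightarrow>\<^sub>E {..<Suc (p * r)} \<and> sorts r n f \<pi>"
    moreover from this have "f (?s n) < Suc (p * r)" if "n \<ge> 1"
      using colored_perm_in_letters(1)[OF \<pi> r, of n] that by (auto simp: PiE_iff)
    ultimately show "b \<in> chains ?D n p" using sorts last unfolding chains by blast
  next
    assume "b \<in> chains ?D n p"
    then have srt: "sorts r n f \<pi>" and ln: "n \<ge> 1 \<Longrightarrow> f (?s n) < Suc (p * r)"
      using sorts last unfolding chains by blast+
    \<comment> \<open>Along the word \<open>f\<close> increases weakly, so the bound at the last
      letter bounds all values.\<close>
    have "f j < Suc (p * r)" if "j \<in> {1..n}" for j
    proof -
      have "j \<in> ?s ` {1..n}" using that forget_colors_bij[OF \<pi> r] by (simp add: bij_betw_def)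
      then obtain i where i: "i \<in> {1..n}" and j: "j = ?s i" by blast
      have n: "n \<in> {1..n}" using i by simp
      show ?thesis
      proof (cases "i = n")
        case True
        then show ?thesis using ln n j by simp
      next
        case False
        then have "rank_key n f (?s i) < rank_key n f (?s n)"
          using srt i n unfolding sorts_def by (intro strict_mono_onD[where f = "\<lambda>i. rank_key n f (?s i)"]) auto
        then have "f (?s i) \<le> f (?s n)"
          using colored_perm_in_letters(1)[OF \<pi> r i] colored_perm_in_letters(1)[OF \<pi> r n]
          by (auto simp: rank_key_less_iff)
        then show ?thesis using ln n j by simp
      qed
    qed
    then show "f \<in> {1..n} \<rightarrow>\<^sub>E {..<Suc (p * r)} \<and> sorts r n f \<pi>"
      using srt ext(1) by (auto simp: PiE_iff)
  qed
qed

lemma card_sorts: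
  assumes r: "r \<ge> 1" and \<pi>: "\<pi> \<in> colored_perms r n"
  shows "card {f \<in> {1..n} \<rightarrow>\<^sub>E {..<Suc (p * r)}. sorts r n f \<pi>} = (p + n - cdes n \<pi>) choose n"
proof -
  let ?s = "forget_colors \<pi>" and ?c = "\<lambda>i. snd (\<pi> (i, 0))"
  let ?D = "\<lambda>i. letter_less (word n \<pi> (i + 1)) (word n \<pi> i)"
  \<comment> \<open>\<open>F\<close> reads off the quotients of \<open>f\<close> by \<open>r\<close>
    along the word; \<open>G\<close> restores \<open>f\<close> from them, the remainders being the
    colors of \<open>\<pi>\<close>.\<close>
  define F where "F f = restrict (\<lambda>i. f (?s i) div r) {1..n}" for f :: "nat \<Rightarrow> nat"
  define G where "G b = restrict (\<lambda>j. b (inv_into {1..n} ?s j) * r + ?c (inv_into {1..n} ?s j)) {1..n}"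
    for b :: "nat \<Rightarrow> nat"
  have bij: "bij_betw ?s {1..n} {1..n}" by (rule forget_colors_bij[OF \<pi> r])
  have s: "?s i \<in> {1..n}" "?c i < r" if "i \<in> {1..n}" for i
    using colored_perm_in_letters[OF \<pi> r that] by auto
  have F: "f (?s i) = F f i * r + ?c i" if "sorts r n f \<pi>" "i \<in> {1..n}" for f i
    using that by (simp add: F_def sorts_def)
  have G: "G b (?s i) = b i * r + ?c i" if "i \<in> {1..n}" for b i
    using that s(1)[OF that] bij by (simp add: G_def inv_into_f_f bij_betw_imp_inj_on)
  have ext: "F f \<in> extensional {1..n}" "G f \<in> extensional {1..n}" for f
    by (auto simp: F_def G_def)
  have extc: "b \<in> extensional {1..n}" if "b \<in> chains ?D n p" for b
    using that by (simp add: chains_def)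
  have "bij_betw F {f \<in> {1..n} \<rightarrow>\<^sub>E {..<Suc (p * r)}. sorts r n f \<pi>} (chains ?D n p)"
  proof (rule bij_betw_byWitness[where f' = G])
    show "F ` {f \<in> {1..n} \<rightarrow>\<^sub>E {..<Suc (p * r)}. sorts r n f \<pi>} \<subseteq> chains ?D n p"
    proof (rule image_subsetI)
      fix f assume f: "f \<in> {f \<in> {1..n} \<rightarrow>\<^sub>E {..<Suc (p * r)}. sorts r n f \<pi>}"
      then show "F f \<in> chains ?D n p"
        using sorts_iff_chains[OF r \<pi> F _ ext(1), of f f] by (auto simp: PiE_def)
    qed
    show "G ` chains ?D n p \<subseteq> {f \<in> {1..n} \<rightarrow>\<^sub>E {..<Suc (p * r)}. sorts r n f \<pi>}"
      using sorts_iff_chains[OF r \<pi> G ext(2) extc] by blast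
    show "\<forall>f\<in>{f \<in> {1..n} \<rightarrow>\<^sub>E {..<Suc (p * r)}. sorts r n f \<pi>}. G (F f) = f"
    proof (intro ballI extensionalityI[of _ "{1..n}"])
      fix f j assume f: "f \<in> {f \<in> {1..n} \<rightarrow>\<^sub>E {..<Suc (p * r)}. sorts r n f \<pi>}" and j: "j \<in> {1..n}"
      have "j \<in> ?s ` {1..n}" using j bij by (simp add: bij_betw_def)
      then obtain i where i: "i \<in> {1..n}" "j = ?s i" by blast
      then show "G (F f) j = f j" using G[of i "F f"] F[of f i] f by simp
    qed (use ext in \<open>auto simp: PiE_def\<close>)
    show "\<forall>b\<in>chains ?D n p. F (G b) = b"
    proof (intro ballI extensionalityI[of _ "{1..n}"])
      fix b i assume i: "i \<in> {1..n}"
      have "F (G b) i = (b i * r + ?c i) div r" using i G[OF i] by (simp add: F_def)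
      also have "\<dots> = b i" using s(2)[OF i] r by simp
      finally show "F (G b) i = b i" .
    qed (use ext extc in auto)
  qed
  then have "card {f \<in> {1..n} \<rightarrow>\<^sub>E {..<Suc (p * r)}. sorts r n f \<pi>} = card (chains ?D n p)"
    by (rule bij_betw_same_card)
  then show ?thesis using finite_card_chains[of ?D n p] by (simp add: cdes_def)
qed

subsection \<open>Bilinearity of the group algebra product\<close>

lemma galg_mult_add_left: "galg_mult G (a + b) c = galg_mult G a c + galg_mult G b c"
  by (simp add: fun_eq_iff galg_mult_def sum_fun_apply qscale_def algebra_simps sum.distrib)

lemma galg_mult_add_right: "galg_mult G c (a + b) = galg_mult G c a + galg_mult G c b"
  by (simp add: fun_eq_iff galg_mult_def sum_fun_apply qscale_def algebra_simps sum.distrib)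

lemma galg_mult_zero_left: "galg_mult G 0 c = 0"
  by (simp add: fun_eq_iff galg_mult_def sum_fun_apply qscale_def)

lemma galg_mult_zero_right: "galg_mult G c 0 = 0"
  by (simp add: fun_eq_iff galg_mult_def sum_fun_apply qscale_def)

lemma galg_mult_scale_left: "galg_mult G (qscale q a) c = qscale q (galg_mult G a c)"
  by (simp add: fun_eq_iff galg_mult_def sum_fun_apply qscale_def sum_distrib_left mult_ac)

lemma galg_mult_scale_right: "galg_mult G c (qscale q a) = qscale q (galg_mult G c a)"
  by (simp add: fun_eq_iff galg_mult_def sum_fun_apply qscale_def sum_distrib_left mult_ac)

lemma galg_mult_sum_left: "galg_mult G (\<Sum>i\<in>A. a i) c = (\<Sum>i\<in>A. galg_mult G (a i) c)"
  by (induction A rule: infinite_finite_induct) 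
    (simp_all only: sum.infinite sum.empty sum.insert galg_mult_add_left galg_mult_zero_left not_False_eq_True)

lemma galg_mult_sum_right: "galg_mult G c (\<Sum>i\<in>A. a i) = (\<Sum>i\<in>A. galg_mult G c (a i))"
  by (induction A rule: infinite_finite_induct) 
    (simp_all only: sum.infinite sum.empty sum.insert galg_mult_add_right galg_mult_zero_right not_False_eq_True)

lemma galg_mult_basis:
  assumes "finite (carrier G)" "g \<in> carrier G" "h \<in> carrier G"
  shows "galg_mult G (galg_basis g) (galg_basis h) = galg_basis (g \<otimes>\<^bsub>G\<^esub> h)"
proof -
  have "galg_mult G (galg_basis g) (galg_basis h) =
      (\<Sum>g'\<in>carrier G. if g' = g then \<Sum>h'\<in>carrier G. if h' = h then galg_basis (g' \<otimes>\<^bsub>G\<^esub> h') else 0 else 0)"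
    unfolding galg_mult_def
    by (intro sum.cong refl)
      (auto simp: fun_eq_iff qscale_def galg_basis_def sum_fun_apply intro!: sum.cong)
  also have "\<dots> = galg_basis (g \<otimes>\<^bsub>G\<^esub> h)"
    using assms by (simp add: sum.delta)
  finally show ?thesis .
qed

subsection \<open>The generating function at integers\<close>

text \<open>Summing over functions instead of permutations makes the product computable by a
  bijection. For \<open>m = Suc (p * r)\<close> this is the generating function at
  \<open>x = m\<close>.\<close>

definition sorting_sum :: "nat \<Rightarrow> nat \<Rightarrow> nat \<Rightarrow> (letter \<Rightarrow> letter) \<Rightarrow> rat" where
  "sorting_sum r n m = (\<Sum>f\<in>{1..n} \<rightarrow>\<^sub>E {..<m}. galg_basis (sorting_perm r n f))"

text \<open>Pairs \<open>(f, g)\<close> correspond to functions \<open>h\<close> below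
  \<open>m' * m\<close> through base-\<open>m\<close> digits, and by \<open>sorts_comp\<close> the
  permutation sorting \<open>h\<close> is the product of those sorting \<open>f\<close> and
  \<open>g\<close>.\<close>

lemma sorting_sum_mult:
  assumes r: "r \<ge> 1" and m: "m mod r = 1 mod r" "m > 0"
  shows "galg_mult (colored_perm_group r n) (sorting_sum r n m) (sorting_sum r n m') =
    sorting_sum r n (m' * m)"
proof -
  let ?F = "\<lambda>m. {1..n} \<rightarrow>\<^sub>E {..<m :: nat}" and ?st = "sorting_perm r n"
  let ?s = "\<lambda>f. forget_colors (?st f)"
  have fin: "finite (carrier (colored_perm_group r n))"
    by (simp add: colored_perm_group_def finite_colored_perms)
  have st: "?st f \<in> carrier (colored_perm_group r n)" for f
    using sorting_perm(1)[OF r] by (simp add: colored_perm_group_def)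
  have bij: "bij_betw (?s f) {1..n} {1..n}" for f
    by (rule forget_colors_bij[OF sorting_perm(1)[OF r] r])
  have s: "?s f k \<in> {1..n}" if "k \<in> {1..n}" for f k using bij that by (rule bij_betw_apply)
  have s': "inv_into {1..n} (?s f) k \<in> {1..n}" if "k \<in> {1..n}" for f k
    using bij_betw_inv_into[OF bij] that by (rule bij_betw_apply)
  have inv: "inv_into {1..n} (?s f) (?s f k) = k" if "k \<in> {1..n}" for f k
    using that bij_betw_imp_inj_on[OF bij] by (simp add: inv_into_f_f)
  have inv': "?s f (inv_into {1..n} (?s f) k) = k" if "k \<in> {1..n}" for f k
    using that bij[of f] by (simp add: bij_betw_def f_inv_into_f)
  \<comment> \<open>\<open>g\<close> is relabeled by the inverse of the permutation sorting
    \<open>f\<close>, as \<open>sorts_comp\<close> demands. For the way back, \<open>P\<close>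
    extracts the low digit \<open>f\<close> first, because \<open>Q\<close> needs its sorting
    permutation to undo the relabeling.\<close>
  define H where "H = (\<lambda>(f, g). restrict (\<lambda>l. g (inv_into {1..n} (?s f) l) * m + f l :: nat) {1..n})"
  define P where "P h = restrict (\<lambda>l. h l mod m) {1..n}" for h :: "nat \<Rightarrow> nat"
  define Q where "Q h = restrict (\<lambda>k. h (?s (P h) k) div m) {1..n}" for h
  have lt: "a * m + b < m' * m" if "a < m'" "b < m" for a b
  proof -
    have "Suc a * m \<le> m' * m" using that by (intro mult_le_mono1) simp
    then show ?thesis using that by simp
  qed
  have Hin: "H fg \<in> ?F (m' * m)" if fg_in: "fg \<in> ?F m \<times> ?F m'" for fg
  proof -
    obtain f g where fg: "fg = (f, g)" "f \<in> ?F m" "g \<in> ?F m'" using fg_in by blast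
    have "g (inv_into {1..n} (?s f) l) * m + f l < m' * m" if "l \<in> {1..n}" for l
      using PiE_mem[OF fg(2) that] PiE_mem[OF fg(3) s'[OF that]] by (intro lt) auto
    then show ?thesis by (simp add: fg(1) H_def)
  qed
  have PHm: "P (H (f, g)) = f" if f: "f \<in> ?F m" for f g
  proof (rule extensionalityI[of _ "{1..n}"])
    fix l assume l: "l \<in> {1..n}"
    then show "P (H (f, g)) l = f l" using PiE_mem[OF f l] by (simp add: P_def H_def)
  qed (use f in \<open>auto simp: P_def PiE_def\<close>)
  have QH: "Q (H (f, g)) = g" if f: "f \<in> ?F m" and g: "g \<in> ?F m'" for f g
  proof (rule extensionalityI[of _ "{1..n}"])
    fix k assume k: "k \<in> {1..n}"
    have "Q (H (f, g)) k = (g k * m + f (?s f k)) div m"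
      unfolding Q_def PHm[OF f] using k s[OF k] inv[OF k] by (simp add: H_def)
    then show "Q (H (f, g)) k = g k" using PiE_mem[OF f s[OF k, of f]] m(2) by simp
  qed (use g in \<open>auto simp: Q_def PiE_def\<close>)
  have PQ: "(P h, Q h) \<in> ?F m \<times> ?F m'" and HPQ: "H (P h, Q h) = h" if h: "h \<in> ?F (m' * m)" for h
  proof -
    have "P h \<in> ?F m" using m(2) by (simp add: P_def)
    moreover have "h (?s (P h) k) div m < m'" if k: "k \<in> {1..n}" for k
      using PiE_mem[OF h s[OF k]] by (simp add: less_mult_imp_div_less)
    then have "Q h \<in> ?F m'" by (simp add: Q_def)
    ultimately show "(P h, Q h) \<in> ?F m \<times> ?F m'" by simp
    show "H (P h, Q h) = h"
    proof (rule extensionalityI[of _ "{1..n}"])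
      fix l assume l: "l \<in> {1..n}"
      then show "H (P h, Q h) l = h l"
        \<comment> \<open>\<open>P\<close> stays folded until the sorting permutation of
          \<open>P h\<close> has cancelled against its inverse; what remains is division with
          remainder by \<open>m\<close>.\<close>
        using s'[OF l] inv'[OF l] by (simp add: H_def Q_def, simp add: P_def)
    qed (use h in \<open>auto simp: H_def PiE_def\<close>)
  qed
  have comp: "?st (H (f, g)) = ?st f \<circ> ?st g" if f: "f \<in> ?F m" for f g
  proof -
    have "sorts r n (H (f, g)) (?st f \<circ> ?st g)"
    proof (rule sorts_comp[OF r m(1) sorting_perm[OF r] sorting_perm[OF r]])
      show "f l < m" if "l \<in> {1..n}" for l using PiE_mem[OF f that] by simp
      show "H (f, g) (?s f k) = g k * m + f (?s f k)" if "k \<in> {1..n}" for k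
        using s[OF that] inv[OF that] by (simp add: H_def)
    qed
    then show ?thesis
      using sorting_perm_eq_iff[OF r colored_perms_comp[OF sorting_perm(1)[OF r] sorting_perm(1)[OF r]]]
      by simp
  qed
  have "galg_mult (colored_perm_group r n) (sorting_sum r n m) (sorting_sum r n m') =
      (\<Sum>f\<in>?F m. \<Sum>g\<in>?F m'. galg_basis (?st f \<circ> ?st g))"
    unfolding sorting_sum_def galg_mult_sum_left galg_mult_sum_right galg_mult_basis[OF fin st st]
    by (simp add: colored_perm_group_def) (rule sum.swap)
  also have "\<dots> = (\<Sum>fg\<in>?F m \<times> ?F m'. galg_basis (?st (fst fg) \<circ> ?st (snd fg)))"
    by (simp add: sum.cartesian_product case_prod_unfold)
  also have "\<dots> = (\<Sum>h\<in>?F (m' * m). galg_basis (?st h))"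
  proof (rule sum.reindex_bij_witness[of _ "\<lambda>h. (P h, Q h)" H])
    fix fg assume "fg \<in> ?F m \<times> ?F m'"
    then obtain f g where fg: "fg = (f, g)" "f \<in> ?F m" "g \<in> ?F m'" by blast
    show "(P (H fg), Q (H fg)) = fg" using fg PHm QH by simp
    show "H fg \<in> ?F (m' * m)" using fg Hin by simp
    show "galg_basis (?st (H fg)) = galg_basis (?st (fst fg) \<circ> ?st (snd fg))"
      using comp[OF fg(2)] fg(1) by simp
  qed (use PQ HPQ in auto)
  finally show ?thesis by (simp add: sorting_sum_def)
qed

lemma cdes_le: "cdes n \<pi> \<le> n"
  using card_mono[of "{1..n}" "{i \<in> {1..n}. letter_less (word n \<pi> (i + 1)) (word n \<pi> i)}"]
  unfolding cdes_def by fastforce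

text \<open>Group the functions by the permutation that sorts them; \<open>card_sorts\<close> gives
  the size of each group.\<close>

lemma sorting_sum_binomial:
  assumes r: "r \<ge> 1"
  shows "sorting_sum r n (Suc (p * r)) =
    (\<Sum>\<pi>\<in>colored_perms r n. qscale (of_nat ((p + n - cdes n \<pi>) choose n)) (galg_basis \<pi>))"
proof -
  let ?F = "{1..n} \<rightarrow>\<^sub>E {..<Suc (p * r)}"
  have "sorting_sum r n (Suc (p * r)) =
      (\<Sum>\<pi>\<in>colored_perms r n. \<Sum>f\<in>{f \<in> ?F. sorting_perm r n f = \<pi>}. galg_basis (sorting_perm r n f))"
    unfolding sorting_sum_def
    by (rule sum.group[symmetric]) (auto simp: finite_PiE finite_colored_perms sorting_perm(1)[OF r])
  also have "\<dots> =
    (\<Sum>\<pi>\<in>colored_perms r n. qscale (of_nat ((p + n - cdes n \<pi>) choose n)) (galg_basis \<pi>))"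
  proof (rule sum.cong[OF refl])
    fix \<pi> assume \<pi>: "\<pi> \<in> colored_perms r n"
    have "(\<Sum>f\<in>{f \<in> ?F. sorting_perm r n f = \<pi>}. galg_basis (sorting_perm r n f)) =
        (\<Sum>f\<in>{f \<in> ?F. sorts r n f \<pi>}. galg_basis \<pi>)"
      by (intro sum.cong) (auto simp: sorting_perm_eq_iff[OF r \<pi>, symmetric])
    also have "\<dots> = qscale (of_nat (card {f \<in> ?F. sorts r n f \<pi>})) (galg_basis \<pi>)"
      by (simp add: fun_eq_iff sum_fun_apply qscale_def)
    finally show "(\<Sum>f\<in>{f \<in> ?F. sorting_perm r n f = \<pi>}. galg_basis (sorting_perm r n f)) =
        qscale (of_nat ((p + n - cdes n \<pi>) choose n)) (galg_basis \<pi>)"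
      using card_sorts[OF r \<pi>] by simp
  qed
  finally show ?thesis .
qed

lemma sorting_sum_expansion:
  assumes r: "r \<ge> 1"
  shows "sorting_sum r n (Suc (p * r)) =
    (\<Sum>i = 0..n. qscale (of_nat (Suc (p * r)) ^ i) (colored_eulerian_idem r n i))"
proof -
  have "((of_nat (Suc (p * r)) - 1) / of_nat r + of_nat n - of_nat (cdes n \<pi>) :: rat) gchoose n =
      of_nat ((p + n - cdes n \<pi>) choose n)" for \<pi>
  proof -
    \<comment> \<open>At \<open>x = rp + 1\<close> the quotient \<open>(x - 1) / r\<close> is
      \<open>p\<close>, and \<open>cdes_le\<close> makes the natural subtraction exact.\<close>
    have "((of_nat (Suc (p * r)) - 1) / of_nat r + of_nat n - of_nat (cdes n \<pi>) :: rat) =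
        of_nat (p + n - cdes n \<pi>)"
      using r cdes_le[of n \<pi>] by (simp add: of_nat_diff trans_le_add2)
    then show ?thesis by (simp only: binomial_gbinomial)
  qed
  then show ?thesis
    unfolding sorting_sum_binomial[OF r] colored_eulerian_idem_expansion[symmetric] by simp
qed


subsection \<open>Comparing coefficients\<close>

lemma polynomial_vanishing_on_progression:
  fixes a :: "nat \<Rightarrow> rat"
  assumes r: "r \<ge> 1" and zero: "\<And>p. (\<Sum>i = 0..n. a i * of_nat (Suc (p * r)) ^ i) = 0" and "i \<le> n"
  shows "a i = 0"
proof -
  define P where "P = (\<Sum>i = 0..n. monom (a i) i)"
  have "P = 0"
  proof (rule ccontr)
    assume "P \<noteq> 0"
    then have "finite {x. poly P x = 0}" by (rule poly_roots_finite)
    moreover have "range (\<lambda>p. of_nat (Suc (p * r)) :: rat) \<subseteq> {x. poly P x = 0}"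
      using zero by (auto simp: P_def poly_sum poly_monom simp del: of_nat_Suc)
    ultimately have "finite (range (\<lambda>p. of_nat (Suc (p * r)) :: rat))" by (rule rev_finite_subset)
    moreover have "inj (\<lambda>p. of_nat (Suc (p * r)) :: rat)"
      using r by (intro injI) (simp del: of_nat_Suc)
    ultimately show False using finite_imageD by blast
  qed
  have "coeff P i = a i"
    using \<open>i \<le> n\<close> by (simp add: P_def coeff_sum sum.delta)
  then show ?thesis using \<open>P = 0\<close> by simp
qed

text \<open>Multiplicativity says that the sum of \<open>x^i y^j c_i c_j\<close> equals the sum of
  \<open>(xy)^i c_i\<close> for all \<open>x\<close>, \<open>y\<close> congruent to 1 in the
  progression. Comparing coefficients in both variables, for each group element \<rho> separately,
  gives idempotence and orthogonality at once.\<close>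

lemma colored_eulerian_idem_mult:
  assumes r: "r \<ge> 1" and i: "i \<le> n" and j: "j \<le> n"
  shows "galg_mult (colored_perm_group r n) (colored_eulerian_idem r n i) (colored_eulerian_idem r n j) =
    (if j = i then colored_eulerian_idem r n i else 0)"
proof
  fix \<rho>
  let ?G = "colored_perm_group r n" and ?c = "colored_eulerian_idem r n"
  let ?x = "\<lambda>p. of_nat (Suc (p * r)) :: rat"
  define M where "M i j = galg_mult ?G (?c i) (?c j) \<rho>" for i j
  have prod: "(\<Sum>i = 0..n. (\<Sum>j = 0..n. (M i j - (if j = i then ?c i \<rho> else 0)) * ?x q ^ j) * ?x p ^ i) = 0"
    for p q
  proof -
    have m: "Suc (p * r) mod r = 1 mod r" by (metis mod_mult_self1 plus_1_eq_Suc)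
    \<comment> \<open>The progression is closed under products:
      \<open>(qr + 1)(pr + 1) = (qpr + q + p)r + 1\<close>.\<close>
    have "galg_mult ?G (sorting_sum r n (Suc (p * r))) (sorting_sum r n (Suc (q * r))) =
        sorting_sum r n (Suc ((q * p * r + q + p) * r))"
      using sorting_sum_mult[OF r m zero_less_Suc] by (simp add: algebra_simps)
    moreover have "?x (q * p * r + q + p) = ?x q * ?x p"
      unfolding of_nat_mult[symmetric] by (simp add: algebra_simps del: of_nat_mult of_nat_Suc)
    ultimately have "galg_mult ?G (\<Sum>i = 0..n. qscale (?x p ^ i) (?c i)) (\<Sum>j = 0..n. qscale (?x q ^ j) (?c j)) =
        (\<Sum>i = 0..n. qscale ((?x q * ?x p) ^ i) (?c i))"
      unfolding sorting_sum_expansion[OF r] by simp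
    from fun_cong[OF this, of \<rho>]
    have total: "(\<Sum>i = 0..n. \<Sum>j = 0..n. ?x p ^ i * (?x q ^ j * M i j)) = (\<Sum>i = 0..n. (?x q * ?x p) ^ i * ?c i \<rho>)"
      unfolding galg_mult_sum_left galg_mult_sum_right galg_mult_scale_left galg_mult_scale_right
      by (subst sum.swap) (simp add: sum_fun_apply qscale_def M_def sum_distrib_left mult_ac del: of_nat_Suc)
    have inner: "(\<Sum>j = 0..n. (M i j - (if j = i then ?c i \<rho> else 0)) * ?x q ^ j) * ?x p ^ i =
        (\<Sum>j = 0..n. ?x p ^ i * (?x q ^ j * M i j)) - (?x q * ?x p) ^ i * ?c i \<rho>" if "i \<in> {0..n}" for i
    proof -
      have "(\<Sum>j = 0..n. (if j = i then ?c i \<rho> else 0) * ?x q ^ j) =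
          (\<Sum>j = 0..n. if j = i then ?c i \<rho> * ?x q ^ i else 0)"
        by (rule sum.cong) auto
      also have "\<dots> = ?c i \<rho> * ?x q ^ i"
        using that by (simp only: sum.delta finite_atLeastAtMost if_True)
      finally have eq: "(\<Sum>j = 0..n. (M i j - (if j = i then ?c i \<rho> else 0)) * ?x q ^ j) =
          (\<Sum>j = 0..n. M i j * ?x q ^ j) - ?c i \<rho> * ?x q ^ i"
        by (simp only: left_diff_distrib sum_subtractf)
      show ?thesis
        unfolding eq
        by (simp only: left_diff_distrib right_diff_distrib sum_distrib_left sum_distrib_right power_mult_distrib mult_ac)
    qed
    show ?thesis
      by (subst sum.cong[OF refl inner], assumption, unfold sum_subtractf total) (rule diff_self)
  qed
  \<comment> \<open>For each fixed \<open>q\<close>, the inner application compares coefficients in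
    \<open>?x p\<close>; the outer one then compares coefficients in \<open>?x q\<close>.\<close>
  have "M i j - (if j = i then ?c i \<rho> else 0) = 0"
    by (rule polynomial_vanishing_on_progression[OF r _ j])
      (rule polynomial_vanishing_on_progression[OF r prod i])
  then show "galg_mult ?G (?c i) (?c j) \<rho> = (if j = i then ?c i else 0) \<rho>"
    by (auto simp: M_def)
qed

subsection \<open>The span\<close>

text \<open>Used for the idempotents and for \<open>sorting_sum\<close>: in both, the coefficient of
  a permutation depends only on its descent number.\<close>

lemma sum_by_cdes:
  "(\<Sum>\<pi>\<in>colored_perms r n. qscale (u (cdes n \<pi>)) (galg_basis \<pi>)) =
   (\<Sum>d = 0..n. qscale (u d) (colored_eulerian_sum r n d))"
proof -
  have "(\<Sum>\<pi>\<in>colored_perms r n. qscale (u (cdes n \<pi>)) (galg_basis \<pi>)) =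
      (\<Sum>d = 0..n. \<Sum>\<pi>\<in>{\<pi> \<in> colored_perms r n. cdes n \<pi> = d}. qscale (u (cdes n \<pi>)) (galg_basis \<pi>))"
    by (rule sum.group[symmetric]) (auto simp: finite_colored_perms cdes_le)
  also have "\<dots> = (\<Sum>d = 0..n. qscale (u d) (colored_eulerian_sum r n d))"
    unfolding colored_eulerian_sum_def
    by (intro sum.cong refl) (simp add: galg.scale_sum_right)
  finally show ?thesis .
qed

lemma colored_eulerian_idem_in_descent_algebra:
  "colored_eulerian_idem r n i \<in> colored_eulerian_descent_algebra r n"
proof -
  have "colored_eulerian_idem r n i = (\<Sum>d = 0..n. qscale (coeff (poly_choose
      (smult (1 / of_nat r) ([:0, 1:] - 1) + of_nat n - of_nat d) n) i) (colored_eulerian_sum r n d))"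
    unfolding colored_eulerian_idem_def colored_eulerian_poly_def
    by (rule sum_by_cdes)
  also have "\<dots> \<in> colored_eulerian_descent_algebra r n"
    unfolding colored_eulerian_descent_algebra_def
    by (intro galg.span_sum galg.span_scale galg.span_base imageI)
  finally show ?thesis .
qed

text \<open>At \<open>x = dr + 1\<close> the coefficient of
  \<open>colored_eulerian_sum r n e\<close> is 0 for \<open>e > d\<close> and 1 for
  \<open>e = d\<close>. This unitriangular system is solved by induction on
  \<open>d\<close>.\<close>

lemma colored_eulerian_sum_in_span_idem:
  assumes r: "r \<ge> 1"
  shows "d \<le> n \<Longrightarrow> colored_eulerian_sum r n d \<in> galg.span (colored_eulerian_idem r n ` {0..n})"
proof (induction d rule: less_induct)
  case (less d)
  let ?C = "colored_eulerian_sum r n" and ?V = "galg.span (colored_eulerian_idem r n ` {0..n})"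
  let ?t = "\<lambda>e. qscale (of_nat ((d + n - e) choose n)) (?C e)"
  have "sorting_sum r n (Suc (d * r)) = (\<Sum>e = 0..n. ?t e)"
    unfolding sorting_sum_binomial[OF r] by (rule sum_by_cdes)
  also have "\<dots> = (\<Sum>e = 0..d. ?t e)"
  proof (rule sum.mono_neutral_right)
    show "\<forall>e\<in>{0..n} - {0..d}. ?t e = 0"
      by (auto simp: binomial_eq_0)
  qed (use less.prems in auto)
  also have "\<dots> = (\<Sum>e<d. ?t e) + ?C d"
    unfolding atLeast0AtMost lessThan_Suc_atMost[symmetric] sum.lessThan_Suc by simp
  finally have eq: "sorting_sum r n (Suc (d * r)) = (\<Sum>e<d. ?t e) + ?C d" .
  have Cd: "?C d = sorting_sum r n (Suc (d * r)) - (\<Sum>e<d. ?t e)"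
    unfolding eq by (rule add_diff_cancel_left'[symmetric])
  show ?case
  proof (subst Cd, rule galg.span_diff)
    show "sorting_sum r n (Suc (d * r)) \<in> ?V"
      unfolding sorting_sum_expansion[OF r]
      by (intro galg.span_sum galg.span_scale galg.span_base imageI)
    show "(\<Sum>e<d. ?t e) \<in> ?V"
    proof (intro galg.span_sum galg.span_scale)
      show "?C e \<in> ?V" if "e \<in> {..<d}" for e
        using less.IH[of e] less.prems that by simp
    qed
  qed
qed

lemma span_colored_eulerian_idem:
  assumes "r \<ge> 1"
  shows "galg.span (colored_eulerian_idem r n ` {0..n}) = colored_eulerian_descent_algebra r n"
proof (rule antisym)
  show "galg.span (colored_eulerian_idem r n ` {0..n}) \<subseteq> colored_eulerian_descent_algebra r n"
    using colored_eulerian_idem_in_descent_algebra unfolding colored_eulerian_descent_algebra_def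
    by (intro galg.span_minimal galg.subspace_span) auto
  show "colored_eulerian_descent_algebra r n \<subseteq> galg.span (colored_eulerian_idem r n ` {0..n})"
    using colored_eulerian_sum_in_span_idem[OF assms] unfolding colored_eulerian_descent_algebra_def
    by (intro galg.span_minimal galg.subspace_span) auto
qed

subsection \<open>The case of one color\<close>

text \<open>All letters have color 0, so they compare by value, and the appended
  \<open>(0, 1)\<close> exceeds them all: \<open>n\<close> is never a descent.\<close>

lemma cdes_eq_des:
  assumes \<pi>: "\<pi> \<in> colored_perms 1 n" and n: "n \<ge> 1"
  shows "cdes n \<pi> = des n (forget_colors \<pi>)"
proof -
  have "\<pi> (i, 0) = (forget_colors \<pi> i, 0)" if "i \<in> {1..n}" for i
    using colored_perm_in_letters(2)[OF \<pi> _ that] by (simp add: forget_colors_def prod_eq_iff)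
  then have w: "word n \<pi> i = (forget_colors \<pi> i, 0)" if "i \<in> {1..n}" for i
    using that by (auto simp: word_def)
  have "letter_less (word n \<pi> (i + 1)) (word n \<pi> i) \<longleftrightarrow> i \<noteq> n \<and> forget_colors \<pi> i > forget_colors \<pi> (i + 1)"
    if i: "i \<in> {1..n}" for i
  proof (cases "i = n")
    case True
    then show ?thesis using w[OF i] by (simp add: word_def letter_less_def)
  next
    case False
    then show ?thesis using w[OF i] w[of "i + 1"] i by (simp add: letter_less_def)
  qed
  then have "{i \<in> {1..n}. letter_less (word n \<pi> (i + 1)) (word n \<pi> i)} =
      {i \<in> {1..n - 1}. forget_colors \<pi> i > forget_colors \<pi> (i + 1)}"
    using n by auto
  then show ?thesis by (simp add: cdes_def des_def)
qed

text \<open>For \<open>r = 1\<close> the argument \<open>(x - 1) / r + n\<close> becomes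
  \<open>x + n - 1\<close>, so the polynomials agree, and the sum is reindexed along the
  isomorphism.\<close>

lemma forget_colors_colored_eulerian_idem:
  assumes n: "n \<ge> 1"
  shows "galg_map (colored_perm_group 1 n) forget_colors (colored_eulerian_idem 1 n i) = eulerian_idem n i"
proof -
  have idem: "colored_eulerian_idem 1 n i \<pi> = coeff (colored_eulerian_poly 1 n \<pi>) i"
    if "\<pi> \<in> colored_perms 1 n" for \<pi>
    using that by (simp add: colored_eulerian_idem_def sum_fun_apply qscale_def galg_basis_def
        finite_colored_perms if_distrib[of "\<lambda>t. _ * t"] sum.delta' cong: if_cong)
  have poly: "colored_eulerian_poly 1 n \<pi> = eulerian_poly n (forget_colors \<pi>)"
    if "\<pi> \<in> colored_perms 1 n" for \<pi>
    using cdes_eq_des[OF that n]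
    by (simp add: colored_eulerian_poly_def eulerian_poly_def algebra_simps)
  have bij: "bij_betw forget_colors (colored_perms 1 n) (carrier (sym_group n))"
    using forget_colors_iso by (auto simp: iso_def colored_perm_group_def)
  have "galg_map (colored_perm_group 1 n) forget_colors (colored_eulerian_idem 1 n i) =
      (\<Sum>\<pi>\<in>colored_perms 1 n.
        qscale (coeff (eulerian_poly n (forget_colors \<pi>)) i) (galg_basis (forget_colors \<pi>)))"
    unfolding galg_map_def using idem poly by (simp add: colored_perm_group_def)
  also have "\<dots> = eulerian_idem n i"
    unfolding eulerian_idem_def by (rule sum.reindex_bij_betw[OF bij])
  finally show ?thesis .
qed

theorem mainTheorem11:
  fixes r n :: nat
  assumes "r \<ge> 1" and "n \<ge> 1"
  shows "(\<forall>i\<in>{0..n}. galg_mult (colored_perm_group r n)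
             (colored_eulerian_idem r n i) (colored_eulerian_idem r n i) =
           colored_eulerian_idem r n i) \<and>
         (\<forall>i\<in>{0..n}. \<forall>j\<in>{0..n}. i \<noteq> j \<longrightarrow>
           galg_mult (colored_perm_group r n)
             (colored_eulerian_idem r n i) (colored_eulerian_idem r n j) = 0) \<and>
         galg.span (colored_eulerian_idem r n ` {0..n}) =
           colored_eulerian_descent_algebra r n \<and>
         (r = 1 \<longrightarrow> (\<forall>i\<in>{1..n}.
           galg_map (colored_perm_group r n) forget_colors (colored_eulerian_idem r n i) =
           eulerian_idem n i))"
  using colored_eulerian_idem_mult[OF assms(1)] span_colored_eulerian_idem[OF assms(1)]
    forget_colors_colored_eulerian_idem[OF assms(2)]
  by auto

end
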